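(* Let $(X,d)$ be a metric space, let $T:X\to X$ be a self-mapping, let $\varphi:X\to[0,\infty)$ be a given function, and let $\rho:=\inf\{d(Tx,x): x\in X,\ x\neq Tx\}$. Let $x_0\in X$ and suppose that $T$ is a type $2$ $\varphi_{x_0}$-contraction with the point $x_0$ and the function $\varphi$. If $\varphi(x_0)=0$ and $\varphi(x)\leq d(Tx,x)$ for all $x\in D_{x_0,\rho}$, then the disc $D_{x_0,\rho}$ is a $\varphi$-fixed disc of $T$.
   Context: Notation: $Fix(T)=\{x\in X: Tx=x\}$, $Z_\varphi=\{x\in X:\varphi(x)=0\}$, and $D_{x_0,r}=\{x\in X: d(x,x_0)\leq r\}$. A disc $D_{x_0,r}$ is a $\varphi$-fixed disc of $T$ if and only if $D_{x_0,r}\subseteq Fix(T)\cap Z_\varphi$. $T$ is a type $2$ $\varphi_{x_0}$-contraction if there is some $k\in(0,1)$ such that, for all $x\in X$, $d(Tx,x)>0$ implies $\max\{d(x,Tx),\varphi(Tx)\}+\varphi(x)\leq k\max\{d(x,x_0),\varphi(x)\}+\varphi(x_0)$. *)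

theory Defs
  imports "HOL-Analysis.Analysis"
begin

definition Fix :: "('a \<Rightarrow> 'a) \<Rightarrow> 'a set" where
  "Fix T = {x. T x = x}"

definition Zeros :: "('a \<Rightarrow> real) \<Rightarrow> 'a set" where
  "Zeros \<phi> = {x. \<phi> x = 0}"

text \<open>
  The radius is extended real, because the infimum \<open>rho T\<close> below is \<open>\<infinity>\<close> when \<open>T\<close> is the
  identity; the disc of radius \<open>\<infinity>\<close> is the whole space.
\<close>
definition disc :: "'a::metric_space \<Rightarrow> ereal \<Rightarrow> 'a set" where
  "disc x0 r = {x. ereal (dist x x0) \<le> r}"

lemma disc_ereal: "disc x0 (ereal r) = cball x0 r"
  by (auto simp: disc_def dist_commute)

lemma disc_infinity: "disc x0 \<infinity> = UNIV"
  by (simp add: disc_def)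

definition phi_fixed_disc ::
  "('a::metric_space \<Rightarrow> 'a) \<Rightarrow> ('a \<Rightarrow> real) \<Rightarrow> 'a \<Rightarrow> ereal \<Rightarrow> bool" where
  "phi_fixed_disc T \<phi> x0 r \<longleftrightarrow> disc x0 r \<subseteq> Fix T \<inter> Zeros \<phi>"

definition type2_phi_contraction ::
  "('a::metric_space \<Rightarrow> 'a) \<Rightarrow> ('a \<Rightarrow> real) \<Rightarrow> 'a \<Rightarrow> bool" where
  "type2_phi_contraction T \<phi> x0 \<longleftrightarrow>
     (\<exists>k::real. 0 < k \<and> k < 1 \<and>
       (\<forall>x. dist (T x) x > 0 \<longrightarrow>
          max (dist x (T x)) (\<phi> (T x)) + \<phi> x \<le> k * max (dist x x0) (\<phi> x) + \<phi> x0))"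

definition rho :: "('a::metric_space \<Rightarrow> 'a) \<Rightarrow> ereal" where
  "rho T = Inf {ereal (dist (T x) x) | x. x \<noteq> T x}"

end

theory Submission
  imports Defs
begin

text \<open>A point \<open>x\<close> of the disc that \<open>T\<close> moves has displacement
  \<open>dist (T x) x\<close> at least \<open>rho T\<close>, hence at least
  \<open>dist x x0\<close>; by \<open>phi_le\<close> it also dominates \<open>\<phi> x\<close>. The
  contraction then bounds this positive displacement by \<open>k\<close> times itself with
  \<open>k < 1\<close>, which is absurd. So \<open>T\<close> fixes the disc pointwise, and there
  \<open>phi_le\<close> squeezes \<open>\<phi>\<close> to zero.\<close>

theorem theorem2p6:
  fixes T :: "'a::metric_space \<Rightarrow> 'a"
    and \<phi> :: "'a \<Rightarrow> real"
    and x0 :: 'a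
  assumes phi_nonneg: "\<forall>x. 0 \<le> \<phi> x"
    and contraction: "type2_phi_contraction T \<phi> x0"
    and phi_x0: "\<phi> x0 = 0"
    and phi_le: "\<forall>x\<in>disc x0 (rho T). \<phi> x \<le> dist (T x) x"
  shows "phi_fixed_disc T \<phi> x0 (rho T)"
proof -
  have "T x = x" if "x \<in> disc x0 (rho T)" for x
  proof (rule ccontr)
    assume "T x \<noteq> x"
    \<comment> \<open>A moved point makes \<open>rho T\<close> finite, so the radius
      \<open>\<infinity>\<close> needs no separate case.\<close>
    then have "rho T \<le> ereal (dist (T x) x)"
      unfolding rho_def by (intro Inf_lower) auto
    then have "ereal (dist x x0) \<le> ereal (dist (T x) x)"
      using that unfolding disc_def by (blast intro: order_trans)
    then have le: "max (dist x x0) (\<phi> x) \<le> dist (T x) x"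
      using phi_le that by simp
    have pos: "dist (T x) x > 0"
      using \<open>T x \<noteq> x\<close> by simp
    then obtain k where k: "0 < k" "k < 1"
      and "max (dist x (T x)) (\<phi> (T x)) + \<phi> x \<le> k * max (dist x x0) (\<phi> x) + \<phi> x0"
      using contraction unfolding type2_phi_contraction_def by blast
    \<comment> \<open>The displacement is one argument of the maximum on the left, and the summand
      \<open>\<phi> x\<close> is nonnegative.\<close>
    then have "dist (T x) x \<le> k * max (dist x x0) (\<phi> x)"
      using phi_nonneg[rule_format, of x] phi_x0 by (simp add: dist_commute)
    also have "\<dots> \<le> k * dist (T x) x"
      using le k by (intro mult_left_mono) auto
    also have "\<dots> < dist (T x) x"
      using k pos by simp
    finally show False by simp
  qed
  \<comment> \<open>At a fixed point the bound \<open>phi_le\<close> reads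
    \<open>\<phi> x \<le> 0\<close>.\<close>
  then show ?thesis
    using phi_nonneg phi_le
    unfolding phi_fixed_disc_def Fix_def Zeros_def by (auto intro: order_antisym)
qed

end
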